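(* Let $H_1,H_2\in\mathbb{C}^{N\times N}$ be Hermitian, $T>0$, $\boldsymbol{u}_I\in\mathbb{C}^N$, and let $\boldsymbol{u}_f(t)=\mathrm{e}^{(H_1+\mathrm{i}H_2)t}\boldsymbol{u}_I$ be the solution of $\frac{\mathrm{d}}{\mathrm{d}t}\boldsymbol{u}_f=(H_1+\mathrm{i}H_2)\boldsymbol{u}_f$, $\boldsymbol{u}_f(0)=\boldsymbol{u}_I$. Let $R>(\lambda^-_{\max}(H_1)+\lambda^+_{\max}(H_1))T$ and let $\psi\in L^2(\mathbb{R})$ satisfy $\psi(p)=\mathrm{e}^{-p}$ for (almost) all $p\in(0,R)$. Let $\boldsymbol{w}\in C([0,T];L^2(\mathbb{R};\mathbb{C}^N))$ be the solution of \[ \partial_t\boldsymbol{w}=-H_1\,\partial_p\boldsymbol{w}+\mathrm{i}H_2\,\boldsymbol{w},\qquad \boldsymbol{w}(0,p)=\psi(p)\,\boldsymbol{u}_I \] (given by the unitary group generated by $-H_1\partial_p+\mathrm{i}H_2$ on $L^2(\mathbb{R};\mathbb{C}^N)$). Then \[ \boldsymbol{u}_f(T)=\mathrm{e}^{p}\,\boldsymbol{w}(T,p)\qquad\text{for (almost) all } p\in\big(\lambda^+_{\max}(H_1)T,\;R-\lambda^-_{\max}(H_1)T\big). \]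
   Context: For a Hermitian matrix $H_1$: $\lambda^+_{\max}(H_1)$ is the largest positive eigenvalue of $H_1$ if one exists and $0$ otherwise; $\lambda^-_{\max}(H_1)$ is the largest absolute value of a negative eigenvalue of $H_1$ if one exists and $0$ otherwise. *)

theory Defs
  imports "HOL-Analysis.Analysis"
begin

definition hermitian :: "complex^'n^'n \<Rightarrow> bool" where
  "hermitian A \<longleftrightarrow> (\<forall>i j. A $ i $ j = cnj (A $ j $ i))"

definition is_eigenvalue :: "complex^'n^'n \<Rightarrow> complex \<Rightarrow> bool" where
  "is_eigenvalue A l \<longleftrightarrow> (\<exists>v. v \<noteq> 0 \<and> A *v v = l *s v)"

definition lambda_plus_max :: "complex^'n^'n \<Rightarrow> real" where
  "lambda_plus_max H =
     (if \<exists>l::real. l > 0 \<and> is_eigenvalue H (complex_of_real l)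
      then Max {l::real. l > 0 \<and> is_eigenvalue H (complex_of_real l)} else 0)"

definition lambda_minus_max :: "complex^'n^'n \<Rightarrow> real" where
  "lambda_minus_max H =
     (if \<exists>l::real. l < 0 \<and> is_eigenvalue H (complex_of_real l)
      then Max (abs ` {l::real. l < 0 \<and> is_eigenvalue H (complex_of_real l)}) else 0)"

definition cinner :: "complex^'n \<Rightarrow> complex^'n \<Rightarrow> complex" where
  "cinner a b = (\<Sum>i\<in>UNIV. a $ i * cnj (b $ i))"

end

theory Submission
  imports Defs
begin

text \<open>
  Both \<open>w\<close> and \<open>exp (- p) *\<^sub>R uf t\<close> solve the hyperbolic equation \<open>v\<^sub>t = - H1 v\<^sub>p + i H2 v\<close>, and they agree
  on \<open>(0, R)\<close> at time \<open>0\<close>. Waves travel with velocities between \<open>- \<lambda>\<^sup>-\<close> and \<open>\<lambda>\<^sup>+\<close>, so the difference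
  still vanishes on \<open>(\<lambda>\<^sup>+ T, R - \<lambda>\<^sup>- T)\<close> at time \<open>T\<close>. As \<open>w\<close> is only a weak solution, the energy
  argument is applied to \<open>Z t s\<close>, the integral of the difference against the translate by \<open>s\<close> of a test
  function \<open>\<phi>\<close>: it is continuously differentiable in \<open>t\<close> and \<open>s\<close> and solves the same equation. Hence
  \<open>Z T 0 = 0\<close> for every \<open>\<phi>\<close> supported in the final interval, which is enough.
\<close>

section \<open>Hermitian matrices\<close>

text \<open>The Rayleigh quotient attains its maximum \<open>k\<close> on the compact unit sphere; a
  maximiser is an eigenvector, so \<open>k\<close> is itself an eigenvalue and hence at most
  \<open>m\<close>. Only real scalars occur, so the lemma can be used on \<open>complex^'n\<close>
  seen as a real Euclidean space.\<close>

lemma selfadjoint_quadratic_form_le: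
  fixes f :: "'a::euclidean_space \<Rightarrow> 'a"
  assumes lin: "linear f" and sa: "\<And>x y. f x \<bullet> y = x \<bullet> f y"
    and ev: "\<And>l v. v \<noteq> 0 \<Longrightarrow> f v = l *\<^sub>R v \<Longrightarrow> l \<le> m"
  shows "f x \<bullet> x \<le> m * (x \<bullet> x)"
proof -
  have "continuous_on (sphere (0::'a) 1) (\<lambda>x. f x \<bullet> x)"
    using lin by (intro continuous_intros linear_continuous_on linear_conv_bounded_linear[THEN iffD1])
  moreover have "sphere (0::'a) 1 \<noteq> {}" by simp
  ultimately obtain u where u: "norm u = 1" and max: "\<And>x. norm x = 1 \<Longrightarrow> f x \<bullet> x \<le> f u \<bullet> u"
    using continuous_attains_sup[OF compact_sphere, of "0::'a" 1] by fastforce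
  define k where "k = f u \<bullet> u"
  have le: "f x \<bullet> x \<le> k * (x \<bullet> x)" for x
  proof (cases "x = 0")
    case True
    then show ?thesis using linear_0[OF lin] by simp
  next
    case False
    have "f (x /\<^sub>R norm x) \<bullet> (x /\<^sub>R norm x) \<le> k"
      unfolding k_def using False by (intro max) simp
    moreover have "f (x /\<^sub>R norm x) \<bullet> (x /\<^sub>R norm x) = (f x \<bullet> x) / (x \<bullet> x)"
      by (simp add: linear_cmul[OF lin] dot_square_norm power2_eq_square divide_simps)
    ultimately have "(f x \<bullet> x) / (x \<bullet> x) \<le> k" by simp
    then show ?thesis using False by (simp add: divide_simps)
  qed
  \<comment> \<open>The form \<open>k (x \<bullet> x) - f x \<bullet> x\<close> is nonnegative and vanishes at \<open>u\<close>; moving from \<open>u\<close> in the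
    direction \<open>d\<close> shows that the maximiser \<open>u\<close> is an eigenvector.\<close>
  define d where "d = k *\<^sub>R u - f u"
  define G where "G = k * (d \<bullet> d) - f d \<bullet> d"
  have "G \<ge> 0" using le[of d] by (simp add: G_def)
  have uu: "u \<bullet> u = 1" using u by (simp add: dot_square_norm)
  have expand: "0 \<le> 2 * t * (d \<bullet> d) + t\<^sup>2 * G" for t
  proof -
    have "0 \<le> k * ((u + t *\<^sub>R d) \<bullet> (u + t *\<^sub>R d)) - f (u + t *\<^sub>R d) \<bullet> (u + t *\<^sub>R d)"
      using le by simp
    also have "\<dots> = (k * (u \<bullet> u) - f u \<bullet> u) + 2 * t * ((k *\<^sub>R u - f u) \<bullet> d) + t\<^sup>2 * G"
      using sa[of d u]
      by (simp add: G_def linear_add[OF lin] linear_cmul[OF lin] inner_simps inner_commute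
          power2_eq_square algebra_simps)
    also have "\<dots> = 2 * t * (d \<bullet> d) + t\<^sup>2 * G"
      using uu by (simp add: k_def[symmetric] d_def[symmetric])
    finally show ?thesis .
  qed
  \<comment> \<open>The step length \<open>t = - D / (G + 1)\<close> makes the negative linear term
    outweigh the quadratic one; adding 1 keeps the denominator positive when
    \<open>G = 0\<close>.\<close>
  define D where "D = d \<bullet> d"
  have "0 \<le> 2 * (- D / (G + 1)) * D + (- D / (G + 1))\<^sup>2 * G"
    using expand[of "- D / (G + 1)"] by (simp add: D_def)
  also have "\<dots> = - (D\<^sup>2 * (G + 2)) / (G + 1)\<^sup>2"
    using \<open>G \<ge> 0\<close> by (simp add: divide_simps power2_eq_square) (simp add: algebra_simps)
  finally have "D\<^sup>2 * (G + 2) \<le> 0"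
    using \<open>G \<ge> 0\<close> by (simp add: divide_simps split: if_splits)
  then have "D = 0" using \<open>G \<ge> 0\<close>
    by (metis add_nonneg_pos mult_le_0_iff not_le power2_less_eq_zero_iff zero_less_numeral zero_le_power2)
  then have "f u = k *\<^sub>R u" by (simp add: D_def d_def)
  then have "k \<le> m" using ev[of u k] u by fastforce
  then show ?thesis using le[of x] by (meson inner_ge_zero mult_right_mono order_trans)
qed

text \<open>Eigenvectors for distinct eigenvalues are orthogonal, and a pairwise orthogonal set in
  finite dimension is finite. This makes the \<open>Max\<close> in the definitions of the extremal
  eigenvalues meaningful.\<close>

lemma finite_eigenvalues_selfadjoint:
  fixes f :: "'a::euclidean_space \<Rightarrow> 'a"
  assumes sa: "\<And>x y. f x \<bullet> y = x \<bullet> f y"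
  shows "finite {l. \<exists>v. v \<noteq> 0 \<and> f v = l *\<^sub>R v}" (is "finite ?L")
proof -
  have "\<forall>l\<in>?L. \<exists>v. v \<noteq> 0 \<and> f v = l *\<^sub>R v" by simp
  from bchoice[OF this] obtain v where v: "\<And>l. l \<in> ?L \<Longrightarrow> v l \<noteq> 0 \<and> f (v l) = l *\<^sub>R v l"
    by blast
  have orth: "v l \<bullet> v m = 0" if "l \<in> ?L" "m \<in> ?L" "l \<noteq> m" for l m
  proof -
    have "l * (v l \<bullet> v m) = m * (v l \<bullet> v m)"
      using sa[of "v l" "v m"] v[OF that(1)] v[OF that(2)] by simp
    then show ?thesis using that(3) by simp
  qed
  have "pairwise orthogonal (v ` ?L)"
  proof (rule pairwiseI)
    fix x y assume "x \<in> v ` ?L" "y \<in> v ` ?L" "x \<noteq> y"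
    then obtain l m where "l \<in> ?L" "m \<in> ?L" "x = v l" "y = v m" by blast
    then show "orthogonal x y"
      using orth[of l m] \<open>x \<noteq> y\<close> unfolding orthogonal_def by blast
  qed
  then have "finite (v ` ?L)" by (rule pairwise_orthogonal_imp_finite)
  moreover have "inj_on v ?L"
  proof (rule inj_onI, rule ccontr)
    fix l m assume lm: "l \<in> ?L" "m \<in> ?L" "v l = v m" "l \<noteq> m"
    then have "v l \<bullet> v l = 0" using orth[of l m] by simp
    then show False using v[OF lm(1)] by simp
  qed
  ultimately show ?thesis by (rule finite_imageD)
qed

section \<open>The Hermitian form and the extremal eigenvalues of a Hermitian matrix\<close>

lemma cinner_matrix_vector_mult:
  assumes "hermitian H"
  shows "cinner a (H *v b) = cinner (H *v a) b"
proof -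
  have "cnj (H $ i $ j) = H $ j $ i" for i j
    using assms by (metis hermitian_def)
  then show ?thesis
    unfolding cinner_def matrix_vector_mult_def
    by (simp add: sum_distrib_left sum_distrib_right, subst sum.swap) (simp add: mult_ac)
qed

text \<open>The bridge from the complex form to the real Euclidean structure in which the energy
  estimate takes place.\<close>

lemma inner_eq_Re_cinner: "a \<bullet> b = Re (cinner a b)"
  by (simp add: inner_vec_def cinner_def inner_complex_def)

lemma hermitian_selfadjoint:
  fixes x y :: "complex^'n"
  assumes "hermitian H"
  shows "(H *v x) \<bullet> y = x \<bullet> (H *v y)"
  by (simp add: inner_eq_Re_cinner cinner_matrix_vector_mult[OF assms])

lemma cinner_commute: "cinner a b = cnj (cinner b a)"
  by (simp add: cinner_def mult.commute)

text \<open>\<open>cinner (H *v x) x\<close> equals its own conjugate, so it is real and turns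
  purely imaginary after multiplication by \<open>\<i>\<close>. Thus the \<open>H2\<close> term
  contributes nothing to the energy balance.\<close>

lemma inner_ii_hermitian:
  assumes "hermitian H"
  shows "(\<i> *s (H *v x)) \<bullet> x = 0"
proof -
  have "Im (cinner (H *v x) x) = 0"
    by (metis cinner_commute cinner_matrix_vector_mult[OF assms] complex_cnj_cancel_iff
        cnj.simps(2) neg_equal_zero)
  moreover have "cinner (\<i> *s (H *v x)) x = \<i> * cinner (H *v x) x"
    by (simp add: cinner_def vector_scalar_mult_def sum_distrib_left mult_ac)
  ultimately show ?thesis by (simp add: inner_eq_Re_cinner)
qed

lemma of_real_smult_eq_scaleR: "complex_of_real l *s v = l *\<^sub>R v"
  by (simp add: vec_eq_iff scaleR_conv_of_real[where 'a = complex])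

lemma finite_real_eigenvalues_hermitian:
  assumes "hermitian (H :: complex^'n^'n)"
  shows "finite {l. is_eigenvalue H (complex_of_real l)}"
  using finite_eigenvalues_selfadjoint[of "(*v) H"] hermitian_selfadjoint[OF assms]
  by (simp add: is_eigenvalue_def of_real_smult_eq_scaleR)

text \<open>Positive eigenvalues lie below the maximum of their finite set. All others lie below 0,
  and the default value 0 keeps the bound nonnegative when no positive eigenvalue exists.\<close>

lemma lambda_plus_max_ge:
  assumes "hermitian H"
  shows "lambda_plus_max H \<ge> 0"
    and "is_eigenvalue H (complex_of_real l) \<Longrightarrow> l \<le> lambda_plus_max H"
proof -
  let ?S = "{l. l > 0 \<and> is_eigenvalue H (complex_of_real l)}"
  have fin: "finite ?S"
    using finite_real_eigenvalues_hermitian[OF assms] by (rule rev_finite_subset) auto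
  then have le: "l \<le> lambda_plus_max H" if "l \<in> ?S" for l
    using that by (auto simp: lambda_plus_max_def)
  then show nonneg: "lambda_plus_max H \<ge> 0"
    by (cases "?S = {}") (fastforce simp: lambda_plus_max_def)+
  show "l \<le> lambda_plus_max H" if "is_eigenvalue H (complex_of_real l)"
    using that le[of l] nonneg by (cases "l > 0") auto
qed

lemma lambda_minus_max_ge:
  assumes "hermitian H"
  shows "lambda_minus_max H \<ge> 0"
    and "is_eigenvalue H (complex_of_real l) \<Longrightarrow> - l \<le> lambda_minus_max H"
proof -
  let ?S = "{l. l < 0 \<and> is_eigenvalue H (complex_of_real l)}"
  have fin: "finite ?S"
    using finite_real_eigenvalues_hermitian[OF assms] by (rule rev_finite_subset) auto
  then have le: "\<bar>l\<bar> \<le> lambda_minus_max H" if "l \<in> ?S" for l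
    using that by (auto simp: lambda_minus_max_def intro!: Max_ge)
  then show nonneg: "lambda_minus_max H \<ge> 0"
    by (cases "?S = {}") (fastforce simp: lambda_minus_max_def)+
  show "- l \<le> lambda_minus_max H" if "is_eigenvalue H (complex_of_real l)"
    using that le[of l] nonneg by (cases "l < 0") auto
qed

lemma quadratic_form_le_lambda_plus_max:
  assumes "hermitian H"
  shows "(H *v x) \<bullet> x \<le> lambda_plus_max H * (x \<bullet> x)"
proof (rule selfadjoint_quadratic_form_le[OF _ hermitian_selfadjoint[OF assms]])
  show "l \<le> lambda_plus_max H" if "v \<noteq> 0" "H *v v = l *\<^sub>R v" for l v
    using that by (intro lambda_plus_max_ge[OF assms])
      (auto simp: is_eigenvalue_def of_real_smult_eq_scaleR)
qed (simp add: linear_linear)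

text \<open>The upper bound for quadratic forms is applied to \<open>- H\<close>, whose eigenvalues
  are the negatives of those of \<open>H\<close>.\<close>

lemma quadratic_form_ge_lambda_minus_max:
  assumes "hermitian H"
  shows "- ((H *v x) \<bullet> x) \<le> lambda_minus_max H * (x \<bullet> x)"
proof -
  have "linear (\<lambda>x. - (H *v x))"
    by (intro linear_compose_neg) (simp add: linear_linear)
  then have "- (H *v x) \<bullet> x \<le> lambda_minus_max H * (x \<bullet> x)"
  proof (rule selfadjoint_quadratic_form_le)
    show "l \<le> lambda_minus_max H" if "v \<noteq> 0" "- (H *v v) = l *\<^sub>R v" for l v
    proof -
      have "H *v v = (- l) *\<^sub>R v" using that(2) by (metis minus_minus scaleR_minus_left)
      then have "is_eigenvalue H (complex_of_real (- l))"
        using that(1) unfolding is_eigenvalue_def of_real_smult_eq_scaleR by blast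
      from lambda_minus_max_ge(2)[OF assms this] show ?thesis by simp
    qed
  qed (simp add: hermitian_selfadjoint[OF assms])
  then show ?thesis by simp
qed

section \<open>Finite speed of propagation\<close>

text \<open>Squaring smooths the kink of \<open>max 0 x\<close> at 0, where the difference quotient
  is bounded by \<open>\<bar>h\<bar>\<close>. The cone weights and the bump functions below are
  built from this function.\<close>

lemma has_real_derivative_max_0_power2:
  "((\<lambda>x. (max 0 x)\<^sup>2) has_real_derivative 2 * max 0 x) (at (x::real))"
proof (cases x "0::real" rule: linorder_cases)
  case greater
  have "((\<lambda>x. x\<^sup>2) has_real_derivative 2 * max 0 x) (at x)"
    using greater by (auto intro!: derivative_eq_intros)
  then show ?thesis
    by (rule has_field_derivative_transform_within_open[of _ _ _ "{0<..}"]) (use greater in auto)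
next
  case less
  have "((\<lambda>x. 0) has_real_derivative 2 * max 0 x) (at x)"
    using less by (auto intro!: derivative_eq_intros)
  then show ?thesis
    by (rule has_field_derivative_transform_within_open[of _ _ _ "{..<0}"]) (use less in auto)
next
  case equal
  have "((\<lambda>h::real. (max 0 h)\<^sup>2 / h) \<longlongrightarrow> 0) (at 0)"
  proof (rule Lim_null_comparison)
    show "\<forall>\<^sub>F h::real in at 0. norm ((max 0 h)\<^sup>2 / h) \<le> \<bar>h\<bar>"
      by (intro always_eventually allI) (auto simp: max_def power2_eq_square)
    show "((\<lambda>h::real. \<bar>h\<bar>) \<longlongrightarrow> 0) (at 0)"
      using tendsto_rabs[OF tendsto_ident_at[of "0::real"]] by simp
  qed
  then show ?thesis using equal by (simp add: has_field_derivative_iff)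
qed

text \<open>A domain-of-dependence argument: what enters at \<open>a\<close> moves right with speed
  at most \<open>lp\<close>, what enters at \<open>b\<close> moves left with speed at most
  \<open>lm\<close>, and neither reaches \<open>s0\<close> by time \<open>T\<close>.\<close>

lemma energy_method_cone:
  fixes Z Zs :: "real \<Rightarrow> real \<Rightarrow> 'a::euclidean_space" and A B :: "'a \<Rightarrow> 'a"
  assumes linA: "linear A" and linB: "linear B"
    and sa: "\<And>x y. A x \<bullet> y = x \<bullet> A y" and skew: "\<And>x. B x \<bullet> x = 0"
    and up: "\<And>x. A x \<bullet> x \<le> lp * (x \<bullet> x)" and lo: "\<And>x. - (A x \<bullet> x) \<le> lm * (x \<bullet> x)"
    and lp: "lp \<ge> 0" and lm: "lm \<ge> 0" and T: "T \<ge> 0"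
    and dt: "\<And>t s. t \<in> {0..T} \<Longrightarrow> s \<in> {a..b} \<Longrightarrow>
      ((\<lambda>t. Z t s) has_vector_derivative (B (Z t s) - A (Zs t s))) (at t within {0..T})"
    and ds: "\<And>t s. t \<in> {0..T} \<Longrightarrow> s \<in> {a..b} \<Longrightarrow>
      (Z t has_vector_derivative Zs t s) (at s within {a..b})"
    and contZ: "continuous_on ({0..T} \<times> {a..b}) (\<lambda>(t, s). Z t s)"
    and contZs: "continuous_on ({0..T} \<times> {a..b}) (\<lambda>(t, s). Zs t s)"
    and init: "\<And>s. s \<in> {a..b} \<Longrightarrow> Z 0 s = 0"
    and s0: "s0 \<in> {a + lp * T<..<b - lm * T}"
  shows "Z T s0 = 0"
proof -
  \<comment> \<open>The weight \<open>q r\<close> lives on the cone shrinking with speeds \<open>lp\<close> and \<open>lm\<close>; \<open>e\<close> is the weighted energy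
    density and \<open>j\<close> its flux, which vanishes at \<open>a\<close> and \<open>b\<close>. The terms of \<open>e' + j'\<close> that do not
    cancel carry a factor \<open>A - lp \<le> 0\<close> or \<open>- A - lm \<le> 0\<close>.\<close>
  define q where "q t s = (max 0 (s - a - lp * t))\<^sup>2" for t s :: real
  define q' where "q' t s = 2 * max 0 (s - a - lp * t)" for t s :: real
  define r where "r t s = (max 0 (b - s - lm * t))\<^sup>2" for t s :: real
  define r' where "r' t s = 2 * max 0 (b - s - lm * t)" for t s :: real
  define c where "c t s = - lp * q' t s * r t s - lm * q t s * r' t s" for t s
  define e where "e t s = q t s * r t s * (Z t s \<bullet> Z t s)" for t s
  define e' where "e' t s = c t s * (Z t s \<bullet> Z t s)
     + q t s * r t s * (2 * ((B (Z t s) - A (Zs t s)) \<bullet> Z t s))" for t s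
  define j where "j t s = q t s * r t s * (A (Z t s) \<bullet> Z t s)" for t s
  define j' where "j' t s = (q' t s * r t s - q t s * r' t s) * (A (Z t s) \<bullet> Z t s)
     + q t s * r t s * (2 * (A (Zs t s) \<bullet> Z t s))" for t s
  note pos_deriv = DERIV_chain2[OF has_real_derivative_max_0_power2]
  have travel: "0 \<le> lp * t" "0 \<le> lm * t" if "t \<in> {0..T}" for t
    using that lp lm by auto
  have s0_ab: "a < s0" "s0 < b" using s0 travel[of T] T by auto
  then have ab: "a < b" by simp
  have nonneg: "q t s \<ge> 0" "r t s \<ge> 0" "q' t s \<ge> 0" "r' t s \<ge> 0" for t s
    by (auto simp: q_def r_def q'_def r'_def)
  have bA: "bounded_linear A" and bB: "bounded_linear B"
    using linA linB by (simp_all add: linear_conv_bounded_linear)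
  have e_deriv: "((\<lambda>t. e t s) has_vector_derivative e' t s) (at t within {0..T})"
    if "t \<in> {0..T}" "s \<in> {a..b}" for t s
  proof -
    have 1: "((\<lambda>t. q t s) has_real_derivative - lp * q' t s) (at t within {0..T})"
    proof -
      have "((\<lambda>t. s - a - lp * t) has_real_derivative - lp) (at t within {0..T})"
        by (auto intro!: derivative_eq_intros)
      from pos_deriv[OF this] show ?thesis by (simp add: q_def q'_def mult_ac)
    qed
    have 2: "((\<lambda>t. r t s) has_real_derivative - lm * r' t s) (at t within {0..T})"
    proof -
      have "((\<lambda>t. b - s - lm * t) has_real_derivative - lm) (at t within {0..T})"
        by (auto intro!: derivative_eq_intros)
      from pos_deriv[OF this] show ?thesis by (simp add: r_def r'_def mult_ac)
    qed
    have 3: "((\<lambda>t. Z t s \<bullet> Z t s) has_real_derivative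
        2 * ((B (Z t s) - A (Zs t s)) \<bullet> Z t s)) (at t within {0..T})"
      using bounded_bilinear.has_vector_derivative[OF bounded_bilinear_inner dt[OF that] dt[OF that]]
      unfolding has_real_derivative_iff_has_vector_derivative
      by (subst (asm) (2) inner_commute) (simp only: mult_2)
    have "((\<lambda>t. e t s) has_real_derivative e' t s) (at t within {0..T})"
      unfolding e_def e'_def c_def
      by (rule DERIV_cong[OF DERIV_mult[OF DERIV_mult[OF 1 2] 3]]) algebra
    then show ?thesis by (simp add: has_real_derivative_iff_has_vector_derivative)
  qed
  have j_deriv: "(j t has_vector_derivative j' t s) (at s within {a..b})"
    if "t \<in> {0..T}" "s \<in> {a..b}" for t s
  proof -
    have 1: "(q t has_real_derivative q' t s) (at s within {a..b})"
    proof -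
      have "((\<lambda>s. s - a - lp * t) has_real_derivative 1) (at s within {a..b})"
        by (auto intro!: derivative_eq_intros)
      from pos_deriv[OF this] show ?thesis by (simp add: q_def[abs_def] q'_def mult_ac)
    qed
    have 2: "(r t has_real_derivative - r' t s) (at s within {a..b})"
    proof -
      have "((\<lambda>s. b - s - lm * t) has_real_derivative - 1) (at s within {a..b})"
        by (auto intro!: derivative_eq_intros)
      from pos_deriv[OF this] show ?thesis by (simp add: r_def[abs_def] r'_def mult_ac)
    qed
    have "((\<lambda>s. A (Z t s) \<bullet> Z t s) has_real_derivative
         (A (Z t s) \<bullet> Zs t s + A (Zs t s) \<bullet> Z t s)) (at s within {a..b})"
      using bounded_bilinear.has_vector_derivative[OF bounded_bilinear_inner
          bounded_linear.has_vector_derivative[OF bA ds[OF that]] ds[OF that]]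
      by (simp add: has_real_derivative_iff_has_vector_derivative)
    \<comment> \<open>Self-adjointness of \<open>A\<close> merges the two product-rule terms into
      one, of the shape needed to cancel against the \<open>Zs\<close> term of
      \<open>e'\<close>.\<close>
    then have 3: "((\<lambda>s. A (Z t s) \<bullet> Z t s) has_real_derivative
         2 * (A (Zs t s) \<bullet> Z t s)) (at s within {a..b})"
      by (rule DERIV_cong) (simp add: sa[of "Z t s" "Zs t s"], simp add: inner_commute)
    have "(j t has_real_derivative j' t s) (at s within {a..b})"
      unfolding j_def[abs_def] j'_def
      by (rule DERIV_cong[OF DERIV_mult[OF DERIV_mult[OF 1 2] 3]]) (simp add: algebra_simps)
    then show ?thesis by (simp add: has_real_derivative_iff_has_vector_derivative)
  qed
  have cont_slice: "continuous_on {a..b} (f t)"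
    if "continuous_on ({0..T} \<times> {a..b}) (\<lambda>(t, s). f t s)" "t \<in> {0..T}"
    for f :: "real \<Rightarrow> real \<Rightarrow> real" and t
  proof -
    have "continuous_on {a..b} (\<lambda>s. (t, s))" by (intro continuous_intros)
    then show ?thesis
      using continuous_on_compose2[OF that(1), of "{a..b}" "\<lambda>s. (t, s)"] that(2) by fastforce
  qed
  have cont_weights: "continuous_on U (\<lambda>x. q (fst x) (snd x))" "continuous_on U (\<lambda>x. r (fst x) (snd x))"
    "continuous_on U (\<lambda>x. q' (fst x) (snd x))" "continuous_on U (\<lambda>x. r' (fst x) (snd x))" for U
    unfolding q_def r_def q'_def r'_def by (intro continuous_intros)+
  note cZ = contZ[unfolded split_beta] contZs[unfolded split_beta]
  have cont_e: "continuous_on ({0..T} \<times> {a..b}) (\<lambda>(t, s). e t s)"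
    unfolding split_beta e_def by (intro continuous_intros cont_weights cZ)
  have cont_e': "continuous_on ({0..T} \<times> {a..b}) (\<lambda>(t, s). e' t s)"
    unfolding split_beta e'_def c_def
    by (intro continuous_intros cont_weights cZ bounded_linear.continuous_on[OF bA]
        bounded_linear.continuous_on[OF bB])
  define E where "E t = integral {a..b} (e t)" for t
  have E_deriv: "(E has_vector_derivative integral {a..b} (e' t)) (at t within {0..T})"
    if "t \<in> {0..T}" for t
    unfolding E_def[abs_def] interval_cbox
    using that cont_e' cont_slice[OF cont_e]
    by (intro leibniz_rule_vector_derivative) (auto intro: e_deriv integrable_continuous_interval)
  \<comment> \<open>The flux vanishes at both ends, so \<open>j'\<close> integrates to 0 and may be
    added to \<open>e'\<close> for free; the sum is then nonpositive pointwise.\<close>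
  have E'_le: "integral {a..b} (e' t) \<le> 0" if t: "t \<in> {0..T}" for t
  proof -
    have "(j' t has_integral (j t b - j t a)) {a..b}"
      using ab j_deriv[OF t] by (intro fundamental_theorem_of_calculus) auto
    moreover have "j t b = 0" "j t a = 0"
      using travel[OF t] by (simp_all add: j_def q_def r_def)
    ultimately have "(j' t has_integral 0) {a..b}" by simp
    moreover have "(e' t has_integral integral {a..b} (e' t)) {a..b}"
      using cont_slice[OF cont_e' t] by (intro integrable_integral integrable_continuous_interval)
    ultimately have "((\<lambda>s. e' t s + j' t s) has_integral (integral {a..b} (e' t) + 0)) {a..b}"
      by (intro has_integral_add)
    then have "integral {a..b} (e' t) + 0 \<le> 0"
    proof (rule has_integral_le[OF _ has_integral_0])
      fix s
      \<comment> \<open>The terms containing \<open>Zs\<close> cancel and the \<open>B\<close> term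
        drops out by skewness.\<close>
      have "e' t s + j' t s = q' t s * r t s * (A (Z t s) \<bullet> Z t s - lp * (Z t s \<bullet> Z t s))
          + q t s * r' t s * (- (A (Z t s) \<bullet> Z t s) - lm * (Z t s \<bullet> Z t s))"
        by (simp add: e'_def j'_def c_def skew inner_diff_left algebra_simps)
      also have "\<dots> \<le> 0 + 0"
        using up[of "Z t s"] lo[of "Z t s"] nonneg
        by (intro add_mono mult_nonneg_nonpos mult_nonneg_nonneg) auto
      finally show "e' t s + j' t s \<le> 0" by simp
    qed
    then show ?thesis by simp
  qed
  have "E T \<le> E 0"
  proof -
    have "\<exists>x\<in>{0..T}. E T - E 0 = (\<lambda>h. h *\<^sub>R integral {a..b} (e' x)) (T - 0)"
      using E_deriv T by (intro mvt_very_simple) (auto simp: has_vector_derivative_def)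
    then obtain x where "x \<in> {0..T}" "E T - E 0 = T * integral {a..b} (e' x)" by auto
    then show ?thesis using mult_nonneg_nonpos[OF T E'_le[of x]] by simp
  qed
  also have "E 0 = integral {a..b} (\<lambda>s. 0)"
    unfolding E_def by (rule integral_cong) (simp add: e_def init)
  finally have "E T \<le> 0" by simp
  have e_nonneg: "e T s \<ge> 0" for s by (simp add: e_def nonneg)
  have int: "e T integrable_on {a..b}"
    using cont_slice[OF cont_e] T by (intro integrable_continuous_interval) auto
  then have "E T = 0"
    using \<open>E T \<le> 0\<close> e_nonneg integral_nonneg[OF int] by (simp add: E_def)
  then have "(e T has_integral 0) (cbox a b)"
    using int by (simp add: E_def has_integral_integrable_integral)
  moreover have "s0 \<in> cbox a b" "box a b \<noteq> {}" using s0_ab by auto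
  ultimately have "e T s0 = 0"
    using has_integral_0_cbox_imp_0[of a b "e T" s0] cont_slice[OF cont_e, of T] T e_nonneg
    by auto
  \<comment> \<open>Both weights are positive at \<open>s0\<close> at time \<open>T\<close>, so the
    vanishing of \<open>e T s0\<close> forces \<open>Z T s0 \<bullet> Z T s0 = 0\<close>.\<close>
  then show ?thesis using s0 by (auto simp: e_def q_def r_def max_def split: if_splits)
qed

section \<open>Testing square-integrable functions\<close>

lemma compact_support_bounded:
  fixes g :: "real \<Rightarrow> real"
  assumes cont: "continuous_on UNIV g" and supp: "\<And>x. x \<notin> {c..d} \<Longrightarrow> g x = 0"
  obtains M where "\<And>x. \<bar>g x\<bar> \<le> M"
proof -
  have "compact (g ` {c..d})"
    by (intro compact_continuous_image continuous_on_subset[OF cont]) auto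
  then obtain M where M: "\<And>x. x \<in> {c..d} \<Longrightarrow> \<bar>g x\<bar> \<le> M"
    using compact_imp_bounded[of "g ` {c..d}"] by (metis bounded_iff imageI real_norm_def)
  then have "\<bar>g x\<bar> \<le> max 0 M" for x using supp[of x] by (cases "x \<in> {c..d}") force+
  then show thesis using that by blast
qed

lemma integrable_compact_support:
  fixes g :: "real \<Rightarrow> 'a::euclidean_space"
  assumes "continuous_on UNIV g" and supp: "\<And>x. x \<notin> {c..d} \<Longrightarrow> g x = 0"
  shows "integrable lborel g"
proof -
  have "integrable lborel (\<lambda>x. indicator {c..d} x *\<^sub>R g x)"
    by (intro borel_integrable_compact continuous_on_subset[OF assms(1)]) auto
  moreover have "(\<lambda>x. indicator {c..d} x *\<^sub>R g x) = g"
    using supp by (auto simp: indicator_def fun_eq_iff)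
  ultimately show ?thesis by simp
qed

text \<open>Square-integrable functions are locally integrable, since
  \<open>norm v \<le> 1 + (norm v)\<^sup>2\<close> and the constant 1 is integrable on a bounded
  interval.\<close>

lemma integrable_indicator_of_square_integrable:
  fixes f :: "real \<Rightarrow> 'a::euclidean_space"
  assumes [measurable]: "f \<in> borel_measurable lborel"
    and L2: "integrable lborel (\<lambda>p. (norm (f p))\<^sup>2)"
  shows "integrable lborel (\<lambda>p. indicator {c..d} p *\<^sub>R f p)"
proof (rule Bochner_Integration.integrable_bound)
  show "integrable lborel (\<lambda>p. indicator {c..d} p + (norm (f p))\<^sup>2)"
    using L2 by (intro Bochner_Integration.integrable_add)
      (auto intro!: integrable_real_indicator simp: emeasure_lborel_Icc_eq)
  have "norm v \<le> 1 + (norm v)\<^sup>2" for v :: 'a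
    using zero_le_power2[of "norm v - 1"] norm_ge_zero[of v]
    unfolding power2_diff power_one by linarith
  then show "AE p in lborel. norm (indicator {c..d} p *\<^sub>R f p) \<le> norm (indicator {c..d} p + (norm (f p))\<^sup>2)"
    by (intro AE_I2) (auto simp: indicator_def)
qed simp

section \<open>Pairing a square-integrable function with translated test functions\<close>

lemma has_vector_derivativeI_quotient:
  fixes f :: "real \<Rightarrow> 'a::real_normed_vector"
  assumes "((\<lambda>y. (f y - f x) /\<^sub>R (y - x)) \<longlongrightarrow> D) (at x)"
  shows "(f has_vector_derivative D) (at x)"
proof -
  have "((\<lambda>y. norm ((f y - f x) /\<^sub>R (y - x) - D)) \<longlongrightarrow> 0) (at x)"
    using assms by (simp add: tendsto_norm_zero_iff Lim_null[symmetric])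
  moreover have "norm ((f y - f x) /\<^sub>R (y - x) - D) = norm (f y - f x - (y - x) *\<^sub>R D) / norm (y - x)"
    if "y \<noteq> x" for y
  proof -
    have "(f y - f x) /\<^sub>R (y - x) - D = (f y - f x - (y - x) *\<^sub>R D) /\<^sub>R (y - x)"
      using that by (simp add: scaleR_diff_right)
    then show ?thesis by (simp add: divide_inverse mult.commute)
  qed
  then have "\<forall>\<^sub>F y in at x. norm ((f y - f x) /\<^sub>R (y - x) - D)
      = norm (f y - f x - (y - x) *\<^sub>R D) / norm (y - x)"
    by (simp add: eventually_at_filter)
  ultimately have "((\<lambda>y. norm (f y - f x - (y - x) *\<^sub>R D) / norm (y - x)) \<longlongrightarrow> 0) (at x)"
    by (rule Lim_transform_eventually)
  then show ?thesis
    by (simp add: has_vector_derivative_def has_derivative_iff_norm bounded_linear_scaleR_left)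
qed

text \<open>The variable \<open>s\<close> sits in the test function, so the result inherits the
  regularity of \<open>g\<close> even when \<open>f\<close> is merely square-integrable.\<close>

definition correlation :: "(real \<Rightarrow> real) \<Rightarrow> (real \<Rightarrow> 'a::euclidean_space) \<Rightarrow> real \<Rightarrow> 'a" where
  "correlation g f s = (LINT p|lborel. g (p - s) *\<^sub>R f p)"

text \<open>With a common bounded support and a common bound, \<open>M * norm (f p)\<close>
  restricted to \<open>{c..d}\<close> is an integrable majorant. Integrability (by a constant
  sequence), continuity and differentiability of correlations all reduce to this.\<close>

lemma correlation_dominated_convergence:
  fixes f :: "real \<Rightarrow> 'a::euclidean_space"
  assumes [measurable]: "f \<in> borel_measurable lborel"
    and L2: "integrable lborel (\<lambda>p. (norm (f p))\<^sup>2)"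
    and hm: "\<And>n. h n \<in> borel_measurable lborel" "k \<in> borel_measurable lborel"
    and supp: "\<And>n p. p \<notin> {c..d} \<Longrightarrow> h n p = 0" and bound: "\<And>n p. \<bar>h n p\<bar> \<le> M"
    and lim: "\<And>p. (\<lambda>n. h n p) \<longlonglongrightarrow> k p"
  shows "integrable lborel (\<lambda>p. k p *\<^sub>R f p)"
    and "(\<lambda>n. LINT p|lborel. h n p *\<^sub>R f p) \<longlonglongrightarrow> (LINT p|lborel. k p *\<^sub>R f p)"
proof -
  note [measurable] = hm
  define D where "D p = M * norm (indicator {c..d} p *\<^sub>R f p)" for p
  have int: "integrable lborel D"
    unfolding D_def
    by (intro integrable_mult_right integrable_norm integrable_indicator_of_square_integrable assms)
  have le: "AE p in lborel. norm (h n p *\<^sub>R f p) \<le> D p" for n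
    using supp bound by (intro AE_I2) (auto simp: D_def indicator_def intro: mult_right_mono)
  have conv: "AE p in lborel. (\<lambda>n. h n p *\<^sub>R f p) \<longlonglongrightarrow> k p *\<^sub>R f p"
    using lim by (intro AE_I2 tendsto_intros)
  have m1: "(\<lambda>p. h n p *\<^sub>R f p) \<in> borel_measurable lborel" for n by simp
  have m2: "(\<lambda>p. k p *\<^sub>R f p) \<in> borel_measurable lborel" by simp
  show "integrable lborel (\<lambda>p. k p *\<^sub>R f p)"
    "(\<lambda>n. LINT p|lborel. h n p *\<^sub>R f p) \<longlonglongrightarrow> (LINT p|lborel. k p *\<^sub>R f p)"
    using integrable_dominated_convergence[OF m2 m1 int conv le]
      integral_dominated_convergence[OF m2 m1 int conv le] by blast+
qed

lemma borel_measurable_translate: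
  fixes g :: "real \<Rightarrow> real"
  assumes "continuous_on UNIV g"
  shows "(\<lambda>p. g (p - s)) \<in> borel_measurable lborel"
proof -
  have "continuous_on UNIV (\<lambda>p. g (p - s))"
    by (rule continuous_on_compose2[OF assms]) (auto intro!: continuous_intros)
  then show ?thesis by (simp add: borel_measurable_continuous_onI)
qed

lemma integrable_correlation:
  fixes f :: "real \<Rightarrow> 'a::euclidean_space" and g :: "real \<Rightarrow> real"
  assumes f: "f \<in> borel_measurable lborel" "integrable lborel (\<lambda>p. (norm (f p))\<^sup>2)"
    and cont: "continuous_on UNIV g" and supp: "\<And>x. x \<notin> {c..d} \<Longrightarrow> g x = 0"
  shows "integrable lborel (\<lambda>p. g (p - s) *\<^sub>R f p)"
proof -
  obtain M where M: "\<And>x. \<bar>g x\<bar> \<le> M" using compact_support_bounded[OF cont supp] by metis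
  show ?thesis
    by (rule correlation_dominated_convergence(1)
          [OF f, where h="\<lambda>n p. g (p - s)" and c="c + s" and d="d + s" and M=M])
       (use M supp cont borel_measurable_translate in auto)
qed

lemma correlation_tendsto_translate:
  fixes f :: "real \<Rightarrow> 'a::euclidean_space" and g :: "real \<Rightarrow> real"
  assumes f: "f \<in> borel_measurable lborel" "integrable lborel (\<lambda>p. (norm (f p))\<^sup>2)"
    and cont: "continuous_on UNIV g" and supp: "\<And>x. x \<notin> {c..d} \<Longrightarrow> g x = 0"
    and s: "s \<longlonglongrightarrow> s0"
  shows "(\<lambda>n. correlation g f (s n)) \<longlonglongrightarrow> correlation g f s0"
proof -
  obtain M where M: "\<And>x. \<bar>g x\<bar> \<le> M" using compact_support_bounded[OF cont supp] by metis
  \<comment> \<open>A bound for the convergent sequence of shifts confines all translated supports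
    to \<open>{c - K..d + K}\<close>.\<close>
  obtain K where K: "\<And>n. \<bar>s n\<bar> \<le> K"
    using convergent_imp_Bseq[OF convergentI[OF s]] by (auto simp: Bseq_def)
  have Kn: "s n \<le> K" "- K \<le> s n" for n using K[of n] by auto
  show ?thesis
    unfolding correlation_def
  proof (rule correlation_dominated_convergence(2)[OF f, where c="c - K" and d="d + K" and M=M])
    show "g (p - s n) = 0" if "p \<notin> {c - K..d + K}" for n p
      using that Kn[of n] by (intro supp) auto
    show "(\<lambda>n. g (p - s n)) \<longlonglongrightarrow> g (p - s0)" for p
      by (rule continuous_on_tendsto_compose[OF cont]) (auto intro!: tendsto_intros s)
  qed (use M cont borel_measurable_translate in auto)
qed

text \<open>Young's inequality with a free parameter takes the place of Cauchy-Schwarz. The bound is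
  uniform in \<open>s\<close> because Lebesgue measure is translation invariant.\<close>

lemma correlation_norm_le:
  fixes f :: "real \<Rightarrow> 'a::euclidean_space" and g :: "real \<Rightarrow> real"
  assumes f: "f \<in> borel_measurable lborel" "integrable lborel (\<lambda>p. (norm (f p))\<^sup>2)"
    and cont: "continuous_on UNIV g" and supp: "\<And>x. x \<notin> {c..d} \<Longrightarrow> g x = 0" and "\<delta> > 0"
  shows "norm (correlation g f s)
    \<le> \<delta> * (LINT x|lborel. (g x)\<^sup>2) + (LINT p|lborel. (norm (f p))\<^sup>2) / \<delta>"
proof -
  have int_g: "integrable lborel (\<lambda>x. (g x)\<^sup>2)"
    by (rule integrable_compact_support[of _ c d]) (auto simp: supp intro!: continuous_intros cont)
  have shift: "integrable lborel (\<lambda>p. (g (p - s))\<^sup>2)"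
      "(LINT p|lborel. (g (p - s))\<^sup>2) = (LINT x|lborel. (g x)\<^sup>2)"
    using lborel_integrable_real_affine[OF int_g, of 1 "- s"]
      lborel_integral_real_affine[of 1 "\<lambda>x. (g x)\<^sup>2" "- s"] by simp_all
  have young: "\<bar>u\<bar> * v \<le> \<delta> * u\<^sup>2 + v\<^sup>2 / \<delta>" if "v \<ge> 0" for u v :: real
  proof -
    have "0 \<le> (\<delta> * \<bar>u\<bar> - v)\<^sup>2 / \<delta>" using \<open>\<delta> > 0\<close> by simp
    also have "\<dots> = \<delta> * u\<^sup>2 + v\<^sup>2 / \<delta> - 2 * (\<bar>u\<bar> * v)"
      using \<open>\<delta> > 0\<close> by (simp add: power2_eq_square field_simps)
    finally show ?thesis using that by (smt (verit) mult_nonneg_nonneg abs_ge_zero)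
  qed
  have "norm (correlation g f s) \<le> (LINT p|lborel. norm (g (p - s) *\<^sub>R f p))"
    unfolding correlation_def by (rule integral_norm_bound)
  also have "\<dots> \<le> (LINT p|lborel. \<delta> * (g (p - s))\<^sup>2 + (norm (f p))\<^sup>2 / \<delta>)"
  proof (rule integral_mono)
    show "integrable lborel (\<lambda>p. norm (g (p - s) *\<^sub>R f p))"
      using integrable_correlation[OF f cont supp] by (rule integrable_norm)
    show "integrable lborel (\<lambda>p. \<delta> * (g (p - s))\<^sup>2 + (norm (f p))\<^sup>2 / \<delta>)"
      using shift(1) f(2) by simp
  qed (simp add: young)
  also have "\<dots> = \<delta> * (LINT x|lborel. (g x)\<^sup>2) + (LINT p|lborel. (norm (f p))\<^sup>2) / \<delta>"
    using shift f(2) by simp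
  finally show ?thesis .
qed

text \<open>The majorant comes from the parallelogram law.\<close>

lemma integrable_norm_diff_power2:
  fixes f h :: "real \<Rightarrow> 'a::euclidean_space"
  assumes f: "f \<in> borel_measurable lborel" "integrable lborel (\<lambda>p. (norm (f p))\<^sup>2)"
    and h: "h \<in> borel_measurable lborel" "integrable lborel (\<lambda>p. (norm (h p))\<^sup>2)"
  shows "integrable lborel (\<lambda>p. (norm (f p - h p))\<^sup>2)"
proof (rule Bochner_Integration.integrable_bound)
  show "integrable lborel (\<lambda>p. 2 * (norm (f p))\<^sup>2 + 2 * (norm (h p))\<^sup>2)"
    using f h by (intro Bochner_Integration.integrable_add integrable_mult_right) auto
  have "(norm (u - v))\<^sup>2 \<le> 2 * (norm u)\<^sup>2 + 2 * (norm v)\<^sup>2" for u v :: 'a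
  proof -
    have "(norm (u - v))\<^sup>2 + (norm (u + v))\<^sup>2 = 2 * (norm u)\<^sup>2 + 2 * (norm v)\<^sup>2"
      by (simp add: power2_norm_eq_inner inner_simps inner_commute)
    then show ?thesis by (smt (verit) zero_le_power2)
  qed
  then show "AE p in lborel. norm ((norm (f p - h p))\<^sup>2) \<le> norm (2 * (norm (f p))\<^sup>2 + 2 * (norm (h p))\<^sup>2)"
    by (intro AE_I2) auto
qed (use f h in measurable)

text \<open>Joint continuity in the function and the shift: the part with \<open>F n - f\<close> is
  small uniformly in the shift, and the remaining part has a fixed function.\<close>

lemma correlation_tendsto:
  fixes f :: "real \<Rightarrow> 'a::euclidean_space" and g :: "real \<Rightarrow> real"
  assumes f: "f \<in> borel_measurable lborel" "integrable lborel (\<lambda>p. (norm (f p))\<^sup>2)"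
    and F: "\<And>n. F n \<in> borel_measurable lborel" "\<And>n. integrable lborel (\<lambda>p. (norm (F n p))\<^sup>2)"
    and cont: "continuous_on UNIV g" and supp: "\<And>x. x \<notin> {c..d} \<Longrightarrow> g x = 0"
    and s: "s \<longlonglongrightarrow> s0" and lim: "(\<lambda>n. LINT p|lborel. (norm (F n p - f p))\<^sup>2) \<longlonglongrightarrow> 0"
  shows "(\<lambda>n. correlation g (F n) (s n)) \<longlonglongrightarrow> correlation g f s0"
proof -
  define C where "C = (LINT x|lborel. (g x)\<^sup>2)"
  define N where "N n = (LINT p|lborel. (norm (F n p - f p))\<^sup>2)" for n
  have C: "C \<ge> 0" and N: "N n \<ge> 0" for n by (simp_all add: C_def N_def)
  note diff = integrable_norm_diff_power2[OF F f]
  have split: "correlation g (F n) r = correlation g (\<lambda>p. F n p - f p) r + correlation g f r" for n r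
    using integrable_correlation[OF F cont supp] integrable_correlation[OF f cont supp]
    by (simp add: correlation_def scaleR_diff_right)
  have le: "norm (correlation g (\<lambda>p. F n p - f p) r) \<le> \<delta> * C + N n / \<delta>" if "\<delta> > 0" for n r \<delta>
    unfolding C_def N_def
    by (intro correlation_norm_le[OF _ diff cont supp that] borel_measurable_diff F f)
  have "(\<lambda>n. correlation g (\<lambda>p. F n p - f p) (s n)) \<longlonglongrightarrow> 0"
  proof (rule tendstoI)
    fix \<epsilon> :: real assume "\<epsilon> > 0"
    \<comment> \<open>This makes \<open>\<delta> * C\<close> less than half of
      \<open>\<epsilon>\<close>, with \<open>C + 1\<close> guarding against \<open>C = 0\<close>;
      afterwards \<open>N n / \<delta>\<close> becomes small as \<open>n\<close> grows.\<close>
    define \<delta> where "\<delta> = \<epsilon> / (2 * (C + 1))"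
    have "\<delta> > 0" using \<open>\<epsilon> > 0\<close> C by (simp add: \<delta>_def)
    have "\<delta> * C < \<epsilon> / 2"
      using \<open>\<epsilon> > 0\<close> C by (simp add: \<delta>_def divide_simps)
    have "\<forall>\<^sub>F n in sequentially. N n < \<delta> * (\<epsilon> / 2)"
      using lim \<open>\<delta> > 0\<close> \<open>\<epsilon> > 0\<close> unfolding N_def[symmetric] by (intro order_tendstoD) auto
    then show "\<forall>\<^sub>F n in sequentially. dist (correlation g (\<lambda>p. F n p - f p) (s n)) 0 < \<epsilon>"
    proof eventually_elim
      case (elim n)
      then have "N n / \<delta> < \<epsilon> / 2" using \<open>\<delta> > 0\<close> by (simp add: field_simps)
      then show ?case
        using le[OF \<open>\<delta> > 0\<close>, of n "s n"] \<open>\<delta> * C < \<epsilon> / 2\<close>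
        unfolding dist_norm diff_0_right by linarith
    qed
  qed
  from tendsto_add[OF this correlation_tendsto_translate[OF f cont supp s]]
  show ?thesis by (simp flip: split)
qed

text \<open>The derivative falls on the test function, with a minus sign from \<open>p - s\<close>.
  Its difference quotients are bounded by the Lipschitz constant \<open>M\<close>, so dominated
  convergence applies.\<close>

lemma correlation_has_vector_derivative:
  fixes f :: "real \<Rightarrow> 'a::euclidean_space" and g g' :: "real \<Rightarrow> real"
  assumes f: "f \<in> borel_measurable lborel" "integrable lborel (\<lambda>p. (norm (f p))\<^sup>2)"
    and deriv: "\<And>x. (g has_real_derivative g' x) (at x)"
    and cont': "continuous_on UNIV g'"
    and supp: "\<And>x. x \<notin> {c..d} \<Longrightarrow> g x = 0" and supp': "\<And>x. x \<notin> {c..d} \<Longrightarrow> g' x = 0"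
  shows "(correlation g f has_vector_derivative - correlation g' f s0) (at s0)"
proof -
  have cont: "continuous_on UNIV g"
    using deriv DERIV_isCont by (intro continuous_at_imp_continuous_on) blast
  obtain M where M: "\<And>x. \<bar>g' x\<bar> \<le> M" using compact_support_bounded[OF cont' supp'] by metis
  have lip: "\<bar>g x - g y\<bar> \<le> M * \<bar>x - y\<bar>" for x y
    using field_differentiable_bound[of UNIV g g' M x y] deriv M by (simp add: has_field_derivative_at_within)
  have quotient: "(\<lambda>n. (correlation g f (s n) - correlation g f s0) /\<^sub>R (s n - s0))
      \<longlonglongrightarrow> - correlation g' f s0"
    if s: "s \<longlonglongrightarrow> s0" and ne: "\<And>n. s n \<noteq> s0" for s
  proof -
    obtain K where K: "\<And>n. \<bar>s n\<bar> \<le> K"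
      using convergent_imp_Bseq[OF convergentI[OF s]] by (auto simp: Bseq_def)
    have Kn: "s n \<le> K" "- K \<le> s n" for n using K[of n] by auto
    have K0: "s0 \<le> K" "- K \<le> s0"
      using LIMSEQ_le_const2[OF s] LIMSEQ_le_const[OF s] Kn by blast+
    define h where "h n p = (g (p - s n) - g (p - s0)) / (s n - s0)" for n p
    have "(\<lambda>n. LINT p|lborel. h n p *\<^sub>R f p) \<longlonglongrightarrow> (LINT p|lborel. (- g' (p - s0)) *\<^sub>R f p)"
    proof (rule correlation_dominated_convergence(2)[OF f, where c="c - K" and d="d + K" and M=M])
      show "h n p = 0" if "p \<notin> {c - K..d + K}" for n p
        unfolding h_def using that Kn[of n] K0 supp[of "p - s n"] supp[of "p - s0"] by auto
      show "\<bar>h n p\<bar> \<le> M" for n p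
        using lip[of "p - s n" "p - s0"] ne[of n]
        by (simp add: h_def divide_simps abs_minus_commute)
      show "(\<lambda>n. h n p) \<longlonglongrightarrow> - g' (p - s0)" for p
      proof -
        have "((\<lambda>s. g (p - s)) has_real_derivative - g' (p - s0)) (at s0)"
          by (rule DERIV_cong[OF DERIV_chain2[OF deriv]]) (auto intro!: derivative_eq_intros)
        then have "((\<lambda>y. (g (p - y) - g (p - s0)) / (y - s0)) \<longlongrightarrow> - g' (p - s0)) (at s0)"
          by (simp add: has_field_derivative_iff)
        then show ?thesis
          unfolding h_def using s ne
          by (auto simp: tendsto_at_iff_sequentially o_def)
      qed
      show "h n \<in> borel_measurable lborel" for n
        unfolding h_def[abs_def] using borel_measurable_translate[OF cont] by measurable
      show "(\<lambda>p. - g' (p - s0)) \<in> borel_measurable lborel"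
        using borel_measurable_translate[OF cont'] by measurable
    qed
    moreover have "(LINT p|lborel. h n p *\<^sub>R f p)
        = (correlation g f (s n) - correlation g f s0) /\<^sub>R (s n - s0)" for n
    proof -
      have "(LINT p|lborel. h n p *\<^sub>R f p)
          = (LINT p|lborel. inverse (s n - s0) *\<^sub>R (g (p - s n) *\<^sub>R f p - g (p - s0) *\<^sub>R f p))"
        by (intro Bochner_Integration.integral_cong)
           (auto simp: h_def divide_inverse scaleR_diff_left[symmetric] mult.commute)
      also have "\<dots> = inverse (s n - s0) *\<^sub>R (correlation g f (s n) - correlation g f s0)"
        using integrable_correlation[OF f cont supp] by (simp add: correlation_def)
      finally show ?thesis .
    qed
    ultimately show ?thesis by (simp add: correlation_def)
  qed
  have "((\<lambda>y. (correlation g f y - correlation g f s0) /\<^sub>R (y - s0)) \<longlongrightarrow> - correlation g' f s0) (at s0)"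
    unfolding tendsto_at_iff_sequentially using quotient by (auto simp: o_def)
  then show ?thesis
    by (rule has_vector_derivativeI_quotient)
qed

section \<open>Continuously differentiable bumps and the fundamental lemma of the calculus of
  variations\<close>

lemma bump_functions:
  fixes c d :: real
  assumes "c < d"
  obtains \<phi> \<phi>' :: "nat \<Rightarrow> real \<Rightarrow> real"
  where "\<And>n x. (\<phi> n has_real_derivative \<phi>' n x) (at x)" "\<And>n. continuous_on UNIV (\<phi>' n)"
    "\<And>n x. x \<notin> {c..d} \<Longrightarrow> \<phi> n x = 0" "\<And>n x. x \<notin> {c..d} \<Longrightarrow> \<phi>' n x = 0"
    "\<And>n x. \<bar>\<phi> n x\<bar> \<le> 1" "\<And>x. (\<lambda>n. \<phi> n x) \<longlonglongrightarrow> indicator {c<..<d} x"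
proof -
  \<comment> \<open>The bumps are \<open>y\<^sup>2 / (1 + y\<^sup>2)\<close> with \<open>y = n max(0, (x - c)(d - x))\<close>; squaring makes them \<open>C\<^sup>1\<close>.\<close>
  define r where "r x = (x - c) * (d - x)" for x
  define P where "P n x = (real n)\<^sup>2 * (max 0 (r x))\<^sup>2" for n x
  define P' where "P' n x = (real n)\<^sup>2 * (2 * max 0 (r x) * (c + d - 2 * x))" for n x
  have r_pos: "r x > 0 \<longleftrightarrow> x \<in> {c<..<d}" for x
    using assms by (auto simp: r_def zero_less_mult_iff)
  have P_nonneg: "P n x \<ge> 0" for n x by (simp add: P_def)
  then have P1: "1 + P n x \<noteq> 0" for n x by (smt (verit))
  have P0: "P n x = 0" "P' n x = 0" if "x \<notin> {c<..<d}" for n x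
    using that r_pos[of x] by (auto simp: P_def P'_def max_def)
  have P_deriv: "(P n has_real_derivative P' n x) (at x)" for n x
  proof -
    have "(r has_real_derivative c + d - 2 * x) (at x)"
      unfolding r_def[abs_def] by (auto intro!: derivative_eq_intros)
    from DERIV_cmult[OF DERIV_chain2[OF has_real_derivative_max_0_power2 this], of "(real n)\<^sup>2"]
    show ?thesis by (simp add: P_def[abs_def] P'_def)
  qed
  have contP: "continuous_on UNIV (P n)" "continuous_on UNIV (P' n)" for n
    unfolding P_def[abs_def] P'_def[abs_def] r_def by (intro continuous_intros)+
  show thesis
  proof (rule that[of "\<lambda>n x. P n x / (1 + P n x)" "\<lambda>n x. P' n x / (1 + P n x)\<^sup>2"])
    show "((\<lambda>x. P n x / (1 + P n x)) has_real_derivative P' n x / (1 + P n x)\<^sup>2) (at x)" for n x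
      using P1 by (auto intro!: derivative_eq_intros P_deriv simp: power2_eq_square algebra_simps)
    show "continuous_on UNIV (\<lambda>x. P' n x / (1 + P n x)\<^sup>2)" for n
      using P1 by (intro continuous_intros contP) auto
    show "(\<lambda>n. P n x / (1 + P n x)) \<longlonglongrightarrow> indicator {c<..<d} x" for x
    proof (cases "x \<in> {c<..<d}")
      case True
      then have "r x > 0" by (simp add: r_pos)
      then have "LIM n sequentially. 1 + (r x)\<^sup>2 * (real n)\<^sup>2 :> at_top"
        by (intro filterlim_tendsto_add_at_top[OF tendsto_const]
            filterlim_tendsto_pos_mult_at_top[OF tendsto_const]
            filterlim_pow_at_top filterlim_real_sequentially) simp_all
      from tendsto_diff[OF tendsto_const tendsto_inverse_0_at_top[OF this], of 1]
      have "(\<lambda>n. 1 - inverse (1 + (r x)\<^sup>2 * (real n)\<^sup>2)) \<longlonglongrightarrow> 1" by simp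
      moreover have "1 - inverse (1 + (r x)\<^sup>2 * (real n)\<^sup>2) = P n x / (1 + P n x)" for n
        using P1[of n x] \<open>r x > 0\<close> by (simp add: P_def divide_simps mult.commute)
      ultimately show ?thesis using True by simp
    qed (simp add: P0)
    show "\<bar>P n x / (1 + P n x)\<bar> \<le> 1" for n x using P_nonneg[of n x] by simp
  qed (auto simp: P0)
qed

text \<open>Bumps increasing to an indicator show that \<open>f\<close> integrates to 0 over open
  intervals; a Dynkin-class argument extends this to all Borel sets, which forces \<open>f\<close>
  to vanish almost everywhere.\<close>

lemma fundamental_lemma_variations:
  fixes f :: "real \<Rightarrow> 'a::euclidean_space"
  assumes f: "\<And>c d. \<alpha> < c \<Longrightarrow> d < \<beta> \<Longrightarrow> set_integrable lborel {c..d} f"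
    and zero: "\<And>c d \<phi> \<phi>'. \<alpha> < c \<Longrightarrow> c < d \<Longrightarrow> d < \<beta>
      \<Longrightarrow> (\<And>x. (\<phi> has_real_derivative \<phi>' x) (at x)) \<Longrightarrow> continuous_on UNIV \<phi>'
      \<Longrightarrow> (\<And>x. x \<notin> {c..d} \<Longrightarrow> \<phi> x = 0) \<Longrightarrow> (\<And>x. x \<notin> {c..d} \<Longrightarrow> \<phi>' x = 0)
      \<Longrightarrow> (LINT x|lborel. \<phi> x *\<^sub>R f x) = 0"
  shows "AE x in lborel. x \<in> {\<alpha><..<\<beta>} \<longrightarrow> f x = 0"
proof -
  have open_zero: "set_lebesgue_integral lborel {c<..<d} f = 0" if "\<alpha> < c" "d < \<beta>" for c d
  proof (cases "c < d")
    case True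
    obtain \<phi> \<phi>' :: "nat \<Rightarrow> real \<Rightarrow> real"
      where \<phi>: "\<And>n x. (\<phi> n has_real_derivative \<phi>' n x) (at x)" "\<And>n. continuous_on UNIV (\<phi>' n)"
        "\<And>n x. x \<notin> {c..d} \<Longrightarrow> \<phi> n x = 0" "\<And>n x. x \<notin> {c..d} \<Longrightarrow> \<phi>' n x = 0"
      and le: "\<And>n x. \<bar>\<phi> n x\<bar> \<le> 1" and lim: "\<And>x. (\<lambda>n. \<phi> n x) \<longlonglongrightarrow> indicator {c<..<d} x"
      using bump_functions[OF True] by metis
    have [measurable]: "\<phi> n \<in> borel_measurable borel" for n
      using \<phi>(1) DERIV_isCont
      by (intro borel_measurable_continuous_onI continuous_at_imp_continuous_on) blast
    \<comment> \<open>Cutting off to the common support of the bumps changes no integral and makes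
      \<open>norm (F x)\<close> an integrable majorant.\<close>
    define F where "F x = indicator {c..d} x *\<^sub>R f x" for x
    have int: "integrable lborel F"
      using f[OF that] by (simp add: F_def[abs_def] set_integrable_def)
    then have [measurable]: "F \<in> borel_measurable lborel" by auto
    have "(\<lambda>n. LINT x|lborel. \<phi> n x *\<^sub>R F x) \<longlonglongrightarrow> (LINT x|lborel. indicator {c<..<d} x *\<^sub>R F x)"
    proof (rule integral_dominated_convergence)
      show "integrable lborel (\<lambda>x. norm (F x))" using int by simp
      show "AE x in lborel. (\<lambda>n. \<phi> n x *\<^sub>R F x) \<longlonglongrightarrow> indicator {c<..<d} x *\<^sub>R F x"
        by (intro AE_I2 tendsto_intros lim)
      show "AE x in lborel. norm (\<phi> n x *\<^sub>R F x) \<le> norm (F x)" for n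
        using mult_right_mono[OF le] by (intro AE_I2) fastforce
    qed measurable
    moreover have "(LINT x|lborel. \<phi> n x *\<^sub>R F x) = 0" for n
    proof -
      have "(LINT x|lborel. \<phi> n x *\<^sub>R F x) = (LINT x|lborel. \<phi> n x *\<^sub>R f x)"
        using \<phi>(3) by (intro Bochner_Integration.integral_cong) (auto simp: F_def indicator_def)
      then show ?thesis using zero[OF that(1) True that(2) \<phi>] by simp
    qed
    moreover have "(LINT x|lborel. indicator {c<..<d} x *\<^sub>R F x) = set_lebesgue_integral lborel {c<..<d} f"
      unfolding set_lebesgue_integral_def
      by (intro Bochner_Integration.integral_cong) (auto simp: F_def indicator_def)
    ultimately show ?thesis by (simp add: LIMSEQ_const_iff)
  qed (simp add: set_lebesgue_integral_def)
  have "AE x in lborel. x \<in> {c<..<d} \<longrightarrow> f x = 0" if cd: "\<alpha> < c" "d < \<beta>" for c d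
  proof -
    define F where "F x = indicator {c<..<d} x *\<^sub>R f x" for x
    have int: "integrable lborel F"
      unfolding F_def[abs_def] set_integrable_def[symmetric]
      by (rule set_integrable_subset[OF f[OF cd]]) auto
    have intA: "integrable lborel (\<lambda>x. indicator A x *\<^sub>R F x)" if "A \<in> sets borel" for A
      using int that by (intro integrable_mult_indicator) auto
    have total: "integral\<^sup>L lborel F = 0"
      using open_zero[OF cd] by (simp add: F_def[abs_def] set_lebesgue_integral_def)
    have "AE x in lborel. F x = 0"
    proof (rule sigma_finite_measure.density_zero[OF sigma_finite_lborel int])
      fix A :: "real set" assume "A \<in> sets lborel"
      \<comment> \<open>Open rays form an intersection-stable generator of the Borel sets, and a ray
        meets \<open>{c<..<d}\<close> in an open interval, where the integral is already known to be
        0.\<close>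
      then have "A \<in> sigma_sets UNIV (range greaterThan)"
        by (simp add: borel_Ioi sets_measure_of)
      have stable: "Int_stable (range (greaterThan :: real \<Rightarrow> real set))"
        by (auto simp: Int_stable_def lessThan_Int_lessThan)
      from stable subset_UNIV[of "range greaterThan", folded Pow_UNIV]
        \<open>A \<in> sigma_sets UNIV (range greaterThan)\<close>
      show "set_lebesgue_integral lborel A F = 0"
      proof (induction rule: sigma_sets_induct_disjoint)
        case (basic A)
        then obtain x where "A = {x<..}" by auto
        then have "set_lebesgue_integral lborel A F = set_lebesgue_integral lborel {max x c<..<d} f"
          unfolding set_lebesgue_integral_def
          by (intro Bochner_Integration.integral_cong) (auto simp: F_def indicator_def)
        then show ?case using open_zero[of "max x c" d] cd by simp
      next
        case empty
        then show ?case by (simp add: set_lebesgue_integral_def)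
      next
        case (compl A)
        then have A: "A \<in> sets borel" by (simp add: borel_Ioi sets_measure_of)
        have "set_lebesgue_integral lborel (UNIV - A) F
            = (LINT x|lborel. F x - indicator A x *\<^sub>R F x)"
          unfolding set_lebesgue_integral_def
          by (intro Bochner_Integration.integral_cong) (auto simp: indicator_def)
        then show ?case
          using compl int intA[OF A] total by (simp add: set_lebesgue_integral_def)
      next
        case (union A)
        then have A: "A i \<in> sets borel" for i by (auto simp: borel_Ioi sets_measure_of)
        have "set_lebesgue_integral lborel (\<Union>i. A i) F = (\<Sum>i. set_lebesgue_integral lborel (A i) F)"
          using union(1) A int
          by (intro lebesgue_integral_countable_add)
             (auto simp: disjoint_family_on_def set_integrable_def intro!: intA)
        then show ?case using union by simp
      qed
    qed
    then show ?thesis by eventually_elim (auto simp: F_def)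
  qed
  \<comment> \<open>Integrability is available only on compact subintervals, so the open interval is
    exhausted by countably many of them and the null sets are united.\<close>
  then have "AE x in lborel. \<forall>n::nat. x \<in> {\<alpha> + inverse (Suc n)<..<\<beta> - inverse (Suc n)} \<longrightarrow> f x = 0"
    by (subst AE_all_countable) auto
  then show ?thesis
  proof eventually_elim
    case (elim x)
    show ?case
    proof
      assume "x \<in> {\<alpha><..<\<beta>}"
      then obtain n where "inverse (real (Suc n)) < min (x - \<alpha>) (\<beta> - x)"
        using reals_Archimedean[of "min (x - \<alpha>) (\<beta> - x)"] by auto
      then have "x \<in> {\<alpha> + inverse (Suc n)<..<\<beta> - inverse (Suc n)}" by simp
      then show "f x = 0" using elim by blast
    qed
  qed
qed

section \<open>The transport equation\<close>

text \<open>Testing against real multiples of a coordinate vector extracts single components from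
  the scalar weak formulation.\<close>

lemma cinner_scaleR_axis: "cinner a (r *\<^sub>R axis j 1) = (r *\<^sub>R a) $ j"
proof -
  have "cinner a (r *\<^sub>R axis j 1) = (\<Sum>i\<in>UNIV. if i = j then r *\<^sub>R a $ i else 0)"
    unfolding cinner_def by (intro sum.cong) (auto simp: axis_def scaleR_conv_of_real[where 'a = complex] mult.commute)
  then show ?thesis by simp
qed

text \<open>The second slot is conjugate-linear, which turns the \<open>- \<i>\<close> of the weak
  formulation into the \<open>+ \<i>\<close> of the equation.\<close>

lemma cinner_diff_smult_right: "cinner a (x - \<i> *s y) = cinner a x + \<i> * cinner a y"
  by (simp add: cinner_def sum_distrib_left algebra_simps flip: sum_subtractf sum.distrib)

lemma bounded_linear_ii_matrix_vector_mult:
  "bounded_linear (\<lambda>x. \<i> *s ((H :: complex^'n^'m) *v x))"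
proof -
  have "bounded_linear (\<lambda>x::complex^'m. \<i> *s x)"
    by (intro linear_conv_bounded_linear[THEN iffD1] linearI)
       (simp_all add: vector_add_ldistrib vec_eq_iff)
  from bounded_linear_compose[OF this matrix_vector_mul_bounded_linear] show ?thesis .
qed

theorem theorem5p1:
  fixes H1 H2 :: "complex^'n^'n"
    and T R :: real
    and uI :: "complex^'n"
    and uf :: "real \<Rightarrow> complex^'n"
    and psi :: "real \<Rightarrow> complex"
    and w :: "real \<Rightarrow> real \<Rightarrow> complex^'n"
  assumes herm1: "hermitian H1" and herm2: "hermitian H2"
    and T_pos: "T > 0"
    and uf_ode: "\<And>t. (uf has_vector_derivative (H1 *v uf t + \<i> *s (H2 *v uf t))) (at t)"
    and uf_init: "uf 0 = uI"
    and R_gt: "R > (lambda_minus_max H1 + lambda_plus_max H1) * T"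
    and psi_meas: "psi \<in> borel_measurable lborel"
    and psi_L2: "integrable lborel (\<lambda>p. (norm (psi p))^2)"
    and psi_exp: "AE p in lborel. p \<in> {0<..<R} \<longrightarrow> psi p = complex_of_real (exp (- p))"
    \<comment> \<open>w \<in> C([0,T]; L^2(R; C^N))\<close>
    and w_meas: "\<And>t. t \<in> {0..T} \<Longrightarrow> w t \<in> borel_measurable lborel"
    and w_L2: "\<And>t. t \<in> {0..T} \<Longrightarrow> integrable lborel (\<lambda>p. (norm (w t p))^2)"
    and w_cont: "\<And>t. t \<in> {0..T} \<Longrightarrow>
        ((\<lambda>s. LINT p|lborel. (norm (w s p - w t p))^2) \<longlongrightarrow> 0) (at t within {0..T})"
    \<comment> \<open>initial condition w(0,p) = psi(p) uI\<close>
    and w_init: "AE p in lborel. w 0 p = psi p *s uI"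
    \<comment> \<open>w solves d/dt w = -H1 d/dp w + i H2 w weakly (Ball's sense), tested against C^1_c functions\<close>
    and w_weak: "\<And>phi phi'. (\<And>p. (phi has_vector_derivative phi' p) (at p)) \<Longrightarrow>
        continuous_on UNIV phi' \<Longrightarrow> bounded {p. phi p \<noteq> 0} \<Longrightarrow>
        \<forall>t\<in>{0..T}. ((\<lambda>s. LINT p|lborel. cinner (w s p) (phi p)) has_vector_derivative
           (LINT p|lborel. cinner (w t p) (H1 *v phi' p - \<i> *s (H2 *v phi p)))) (at t within {0..T})"
  shows "AE p in lborel.
           p \<in> {lambda_plus_max H1 * T <..< R - lambda_minus_max H1 * T} \<longrightarrow>
           uf T = complex_of_real (exp p) *s w T p"
proof -
  define lp lm where "lp = lambda_plus_max H1" and "lm = lambda_minus_max H1"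
  define B where "B x = \<i> *s (H2 *v x)" for x :: "complex^'n"
  note bA = matrix_vector_mul_bounded_linear[of H1]
  have bB: "bounded_linear B"
    unfolding B_def[abs_def] by (rule bounded_linear_ii_matrix_vector_mult)
  note linA = bounded_linear.linear[OF bA] and linB = bounded_linear.linear[OF bB]
  have T0: "0 \<in> {0..T}" "T \<in> {0..T}" using T_pos by auto

  have main: "correlation \<phi> (w T) 0 = (LINT x|lborel. \<phi> x * exp (- x)) *\<^sub>R uf T"
    if cd: "lp * T < c" "c < d" "d < R - lm * T"
      and d\<phi>: "\<And>x. (\<phi> has_real_derivative \<phi>' x) (at x)" and cont': "continuous_on UNIV \<phi>'"
      and supp: "\<And>x. x \<notin> {c..d} \<Longrightarrow> \<phi> x = 0" and supp': "\<And>x. x \<notin> {c..d} \<Longrightarrow> \<phi>' x = 0"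
    for c d \<phi> \<phi>'
  proof -
    have cont: "continuous_on UNIV \<phi>"
      using d\<phi> DERIV_isCont by (intro continuous_at_imp_continuous_on) blast
    define K where "K = (LINT x|lborel. \<phi> x * exp (- x))"
    \<comment> \<open>\<open>exp (- s) * K\<close> is the integral of \<open>exp (- p)\<close> against \<open>\<phi> (p - s)\<close>.\<close>
    define Z where "Z t s = correlation \<phi> (w t) s - (exp (- s) * K) *\<^sub>R uf t" for t s
    define Zs where "Zs t s = - correlation \<phi>' (w t) s + (exp (- s) * K) *\<^sub>R uf t" for t s

    \<comment> \<open>Moving \<open>H1\<close> and \<open>H2\<close> across \<open>cinner\<close> in
      the weak equation puts them on the correlations. Since \<open>correlation \<phi>'\<close> is
      minus the \<open>s\<close>-derivative of \<open>correlation \<phi>\<close>, this is the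
      transport equation in \<open>t\<close> and \<open>s\<close>.\<close>
    have weak: "((\<lambda>t. correlation \<phi> (w t) s) has_vector_derivative
        H1 *v correlation \<phi>' (w t) s + B (correlation \<phi> (w t) s)) (at t within {0..T})"
      if t: "t \<in> {0..T}" for t s
    proof -
      have int: "integrable lborel (\<lambda>p. \<phi> (p - s) *\<^sub>R w r p)"
           "integrable lborel (\<lambda>p. \<phi>' (p - s) *\<^sub>R w r p)" if "r \<in> {0..T}" for r
        using integrable_correlation[OF w_meas[OF that] w_L2[OF that]] cont cont' supp supp' by auto
      have comp: "((\<lambda>t. correlation \<phi> (w t) s $ j) has_vector_derivative
        (H1 *v correlation \<phi>' (w t) s + B (correlation \<phi> (w t) s)) $ j) (at t within {0..T})" for j
      proof -
        define \<Phi> where "\<Phi> p = \<phi> (p - s) *\<^sub>R (axis j 1 :: complex^'n)" for p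
        define \<Phi>' where "\<Phi>' p = \<phi>' (p - s) *\<^sub>R (axis j 1 :: complex^'n)" for p
        have d\<Phi>: "(\<Phi> has_vector_derivative \<Phi>' p) (at p)" for p
        proof -
          have "((\<lambda>p. \<phi> (p - s)) has_real_derivative \<phi>' (p - s)) (at p)"
            by (rule DERIV_cong[OF DERIV_chain2[OF d\<phi>]]) (auto intro!: derivative_eq_intros)
          then show ?thesis
            unfolding \<Phi>_def[abs_def] \<Phi>'_def
            by (rule has_vector_derivative_scaleR[OF _ has_vector_derivative_const, simplified])
        qed
        have c\<Phi>': "continuous_on UNIV \<Phi>'"
          unfolding \<Phi>'_def[abs_def]
          by (intro continuous_intros continuous_on_compose2[OF cont']) auto
        have "{p. \<Phi> p \<noteq> 0} \<subseteq> {c + s..d + s}" using supp by (force simp: \<Phi>_def)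
        then have b\<Phi>: "bounded {p. \<Phi> p \<noteq> 0}" using bounded_closed_interval bounded_subset by blast
        have deriv: "((\<lambda>r. LINT p|lborel. cinner (w r p) (\<Phi> p)) has_vector_derivative
          (LINT p|lborel. cinner (w t p) (H1 *v \<Phi>' p - \<i> *s (H2 *v \<Phi> p)))) (at t within {0..T})"
          using w_weak[OF d\<Phi> c\<Phi>' b\<Phi>] t by blast
        have pairing: "(LINT p|lborel. cinner (w r p) (\<Phi> p)) = correlation \<phi> (w r) s $ j"
          if "r \<in> {0..T}" for r
          unfolding \<Phi>_def cinner_scaleR_axis correlation_def
          by (rule integral_bounded_linear[OF bounded_linear_vec_nth int(1)[OF that]])
        have rhs: "(LINT p|lborel. cinner (w t p) (H1 *v \<Phi>' p - \<i> *s (H2 *v \<Phi> p)))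
          = (H1 *v correlation \<phi>' (w t) s + B (correlation \<phi> (w t) s)) $ j"
        proof -
          have pointwise: "cinner (w t p) (H1 *v \<Phi>' p - \<i> *s (H2 *v \<Phi> p))
            = (H1 *v (\<phi>' (p - s) *\<^sub>R w t p) + B (\<phi> (p - s) *\<^sub>R w t p)) $ j" for p
            unfolding cinner_diff_smult_right cinner_matrix_vector_mult[OF herm1]
              cinner_matrix_vector_mult[OF herm2] \<Phi>_def \<Phi>'_def cinner_scaleR_axis
            by (simp add: B_def linear_cmul[OF bounded_linear.linear[OF bA]]
                linear_cmul[OF bounded_linear.linear[OF matrix_vector_mul_bounded_linear[of H2]]])
          have int_eq: "(LINT p|lborel. H1 *v (\<phi>' (p - s) *\<^sub>R w t p) + B (\<phi> (p - s) *\<^sub>R w t p))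
            = H1 *v correlation \<phi>' (w t) s + B (correlation \<phi> (w t) s)"
            unfolding correlation_def
            using integral_bounded_linear[OF bA int(2)[OF t]] integral_bounded_linear[OF bB int(1)[OF t]]
              integrable_bounded_linear[OF bA int(2)[OF t]] integrable_bounded_linear[OF bB int(1)[OF t]]
            by simp
          have "integrable lborel (\<lambda>p. H1 *v (\<phi>' (p - s) *\<^sub>R w t p) + B (\<phi> (p - s) *\<^sub>R w t p))"
            using integrable_bounded_linear[OF bA int(2)[OF t]] integrable_bounded_linear[OF bB int(1)[OF t]]
            by simp
          from integral_bounded_linear[OF bounded_linear_vec_nth this, of j]
          show ?thesis by (simp only: pointwise int_eq)
        qed
        show ?thesis
          by (rule has_vector_derivative_transform[OF t pairing[symmetric] deriv[unfolded rhs]])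
      qed
      \<comment> \<open>Each real basis vector is supported in one complex coordinate, so the
        componentwise derivatives assemble into the vector one.\<close>
      have "((\<lambda>t. correlation \<phi> (w t) s \<bullet> b) has_derivative
          (\<lambda>x. (x *\<^sub>R (H1 *v correlation \<phi>' (w t) s + B (correlation \<phi> (w t) s))) \<bullet> b))
          (at t within {0..T})" if b: "b \<in> Basis" for b
      proof -
        obtain j z where "b = axis j z" using b by (auto simp: Basis_vec_def)
        then have ax: "x \<bullet> b = (x $ j) \<bullet> z" for x by (simp add: inner_axis)
        have "((\<lambda>t. (correlation \<phi> (w t) s $ j) \<bullet> z) has_derivative
          (\<lambda>x. (x *\<^sub>R ((H1 *v correlation \<phi>' (w t) s + B (correlation \<phi> (w t) s)) $ j)) \<bullet> z))
          (at t within {0..T})"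
          using comp[of j] unfolding has_vector_derivative_def by (rule has_derivative_inner_left)
        then show ?thesis by (simp only: ax vector_scaleR_component)
      qed
      then show ?thesis
        unfolding has_vector_derivative_def
        by (subst has_derivative_componentwise_within) blast
    qed

    \<comment> \<open>For shifts \<open>s\<close> in \<open>{- c..R - d}\<close> the translated
      support \<open>{c + s..d + s}\<close> stays within \<open>{0..R}\<close>, where the initial
      data are known; the conditions on \<open>c\<close> and \<open>d\<close> place
      \<open>s = 0\<close> in the final cone section.\<close>
    have "Z T 0 = 0"
    proof (rule energy_method_cone[where Zs=Zs and A="(*v) H1" and B=B and lp=lp and lm=lm
          and a="- c" and b="R - d"])
      show "linear ((*v) H1)" "linear B" by (rule linA linB)+
      show "(H1 *v x) \<bullet> y = x \<bullet> (H1 *v y)" for x y by (rule hermitian_selfadjoint[OF herm1])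
      show "B x \<bullet> x = 0" for x unfolding B_def by (rule inner_ii_hermitian[OF herm2])
      show "(H1 *v x) \<bullet> x \<le> lp * (x \<bullet> x)" "- ((H1 *v x) \<bullet> x) \<le> lm * (x \<bullet> x)" for x
        unfolding lp_def lm_def
        by (rule quadratic_form_le_lambda_plus_max[OF herm1]
            quadratic_form_ge_lambda_minus_max[OF herm1])+
      show "lp \<ge> 0" "lm \<ge> 0"
        unfolding lp_def lm_def
        by (rule lambda_plus_max_ge[OF herm1] lambda_minus_max_ge[OF herm1])+
      show "T \<ge> 0" using T_pos by simp
      show "0 \<in> {- c + lp * T<..<R - d - lm * T}" using cd by simp
    next
      fix t s assume t: "t \<in> {0..T}" and s: "s \<in> {- c..R - d}"
      have "((\<lambda>t. Z t s) has_vector_derivative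
          (H1 *v correlation \<phi>' (w t) s + B (correlation \<phi> (w t) s))
          - (exp (- s) * K) *\<^sub>R (H1 *v uf t + B (uf t))) (at t within {0..T})"
        unfolding Z_def[abs_def] B_def
        using weak[OF t, of s] has_vector_derivative_at_within[OF uf_ode[of t]]
        unfolding B_def
        by (intro has_vector_derivative_diff
            bounded_linear.has_vector_derivative[OF bounded_linear_scaleR_right])
      \<comment> \<open>The \<open>s\<close>-derivative of \<open>exp (- s) * K\<close> is its
        negative, so transport by \<open>- H1\<close> reproduces the term \<open>H1 *v uf t\<close>
        of the differential equation for \<open>uf\<close>.\<close>
      moreover have "(H1 *v correlation \<phi>' (w t) s + B (correlation \<phi> (w t) s))
          - (exp (- s) * K) *\<^sub>R (H1 *v uf t + B (uf t)) = B (Z t s) - H1 *v Zs t s"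
        unfolding Z_def Zs_def linear_add[OF linA] linear_diff[OF linB] linear_neg[OF linA]
          linear_cmul[OF linA] linear_cmul[OF linB] scaleR_add_right
        by simp
      ultimately show "((\<lambda>t. Z t s) has_vector_derivative B (Z t s) - H1 *v Zs t s) (at t within {0..T})"
        by simp
      have 1: "(correlation \<phi> (w t) has_vector_derivative - correlation \<phi>' (w t) s) (at s)"
        by (rule correlation_has_vector_derivative[OF w_meas[OF t] w_L2[OF t] d\<phi> cont' supp supp'])
      have "((\<lambda>s. exp (- s) * K) has_real_derivative - (exp (- s) * K)) (at s)"
        by (auto intro!: derivative_eq_intros)
      then have 2: "((\<lambda>s. (exp (- s) * K) *\<^sub>R uf t) has_vector_derivative
          (- (exp (- s) * K)) *\<^sub>R uf t) (at s)"
        unfolding has_real_derivative_iff_has_vector_derivative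
        by (rule bounded_linear.has_vector_derivative[OF bounded_linear_scaleR_left])
      have Z_eq: "Z t = (\<lambda>s. correlation \<phi> (w t) s - (exp (- s) * K) *\<^sub>R uf t)"
        unfolding Z_def by (rule refl)
      have Zs_eq: "Zs t s = - correlation \<phi>' (w t) s - (- (exp (- s) * K)) *\<^sub>R uf t"
        by (simp add: Zs_def)
      show "(Z t has_vector_derivative Zs t s) (at s within {- c..R - d})"
        unfolding Z_eq Zs_eq
        by (rule has_vector_derivative_at_within, rule has_vector_derivative_diff[OF 1 2])
    next
      have corr: "continuous_on ({0..T} \<times> {- c..R - d}) (\<lambda>(t, s). correlation g (w t) s)"
        if g: "continuous_on UNIV g" "\<And>x. x \<notin> {c..d} \<Longrightarrow> g x = 0" for g
        unfolding continuous_on_sequentially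
      proof (intro ballI allI impI, elim conjE)
        fix x X assume x: "x \<in> {0..T} \<times> {- c..R - d}" and X: "\<forall>n. X n \<in> {0..T} \<times> {- c..R - d}"
          and lim: "X \<longlonglongrightarrow> x"
        have t: "fst x \<in> {0..T}" "fst (X n) \<in> {0..T}" for n using x X by (auto simp: mem_Times_iff)
        \<comment> \<open>The limit 0 is written as the value at \<open>r = fst x\<close>, so that
          the hypothesis reads as continuity and also covers sequences that hit
          \<open>fst x\<close>.\<close>
        have "((\<lambda>r. LINT p|lborel. (norm (w r p - w (fst x) p))^2) \<longlongrightarrow>
            (LINT p|lborel. (norm (w (fst x) p - w (fst x) p))^2)) (at (fst x) within {0..T})"
          using w_cont[OF t(1)] by simp
        then have "(\<lambda>n. LINT p|lborel. (norm (w (fst (X n)) p - w (fst x) p))^2) \<longlonglongrightarrow>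
            (LINT p|lborel. (norm (w (fst x) p - w (fst x) p))^2)"
          using t lim
          by (intro continuous_within_tendsto_compose'[of "fst x" "{0..T}"
              "\<lambda>r. LINT p|lborel. (norm (w r p - w (fst x) p))^2" "\<lambda>n. fst (X n)"] tendsto_fst)
            (auto simp: continuous_within)
        then have "(\<lambda>n. correlation g (w (fst (X n))) (snd (X n))) \<longlonglongrightarrow> correlation g (w (fst x)) (snd x)"
          using t lim
          by (intro correlation_tendsto[OF w_meas w_L2 w_meas w_L2 g] tendsto_snd) auto
        then show "((\<lambda>(t, s). correlation g (w t) s) \<circ> X) \<longlonglongrightarrow> (case x of (t, s) \<Rightarrow> correlation g (w t) s)"
          by (simp add: o_def split_beta)
      qed
      have uf: "continuous_on UNIV uf"
        using uf_ode by (intro continuous_at_imp_continuous_on) (blast intro: has_vector_derivative_continuous)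
      have "continuous_on ({0..T} \<times> {- c..R - d}) (\<lambda>x. (exp (- snd x) * K) *\<^sub>R uf (fst x))"
        by (intro continuous_intros continuous_on_compose2[OF uf]) auto
      then show "continuous_on ({0..T} \<times> {- c..R - d}) (\<lambda>(t, s). Z t s)"
        "continuous_on ({0..T} \<times> {- c..R - d}) (\<lambda>(t, s). Zs t s)"
        using corr[OF cont supp] corr[OF cont' supp']
        unfolding Z_def Zs_def split_beta by (auto intro!: continuous_intros)
    next
      fix s assume s: "s \<in> {- c..R - d}"
      \<comment> \<open>For extreme \<open>s\<close> the support touches 0 or \<open>R\<close>,
        where \<open>psi\<close> is not prescribed; dropping two points leaves only \<open>p\<close>
        in \<open>{0<..<R}\<close>.\<close>
      have "AE p in lborel. p \<noteq> c + s \<and> p \<noteq> d + s"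
        using AE_lborel_singleton[of "c + s"] AE_lborel_singleton[of "d + s"] by eventually_elim simp
      with w_init psi_exp
      have "AE p in lborel. \<phi> (p - s) *\<^sub>R w 0 p = (\<phi> (p - s) * exp (- p)) *\<^sub>R uf 0"
      proof eventually_elim
        case (elim p)
        show ?case
        proof (cases "p - s \<in> {c..d}")
          case True
          then have "p \<in> {0<..<R}" using elim s by auto
          then show ?thesis using elim by (simp add: of_real_smult_eq_scaleR uf_init)
        qed (simp add: supp)
      qed
      moreover have [measurable]: "\<phi> \<in> borel_measurable borel" "w 0 \<in> borel_measurable lborel"
        using borel_measurable_continuous_onI[OF cont] w_meas[OF T0(1)] by auto
      ultimately have "correlation \<phi> (w 0) s = (LINT p|lborel. (\<phi> (p - s) * exp (- p)) *\<^sub>R uf 0)"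
        unfolding correlation_def by (intro integral_cong_AE) measurable
      also have "\<dots> = (LINT p|lborel. \<phi> (p - s) * exp (- p)) *\<^sub>R uf 0"
      proof (rule integral_scaleR_left)
        show "integrable lborel (\<lambda>p. \<phi> (p - s) * exp (- p))"
          by (rule integrable_compact_support[of _ "c + s" "d + s"])
             (auto simp: supp intro!: continuous_intros continuous_on_compose2[OF cont])
      qed
      \<comment> \<open>The substitution \<open>p = s + x\<close> pulls out the factor
        \<open>exp (- s)\<close>.\<close>
      also have "(LINT p|lborel. \<phi> (p - s) * exp (- p)) = (LINT x|lborel. exp (- s) * (\<phi> x * exp (- x)))"
        by (subst lborel_integral_real_affine[where c=1 and t=s]) (simp_all add: exp_diff exp_minus field_simps)
      also have "\<dots> = exp (- s) * K" by (simp add: K_def)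
      finally show "Z 0 s = 0" by (simp add: Z_def)
    qed
    then show ?thesis by (simp add: Z_def K_def)
  qed

  define f where "f p = w T p - exp (- p) *\<^sub>R uf T" for p
  have f_int: "set_integrable lborel {c..d} f" for c d
    unfolding f_def[abs_def]
  proof (rule set_integral_diff)
    show "set_integrable lborel {c..d} (w T)"
      unfolding set_integrable_def
      by (rule integrable_indicator_of_square_integrable[OF w_meas[OF T0(2)] w_L2[OF T0(2)]])
    show "set_integrable lborel {c..d} (\<lambda>p. exp (- p) *\<^sub>R uf T)"
      by (intro borel_integrable_atLeastAtMost' continuous_intros)
  qed
  \<comment> \<open>By \<open>main\<close>, \<open>f\<close> pairs to 0 with every admissible test
    function; multiplying \<open>f p = 0\<close> by \<open>exp p\<close> then gives the
    claim.\<close>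
  have "AE p in lborel. p \<in> {lp * T<..<R - lm * T} \<longrightarrow> f p = 0"
  proof (rule fundamental_lemma_variations[OF f_int])
    fix c d \<phi> \<phi>'
    assume cd: "lp * T < c" "c < d" "d < R - lm * T"
      and d\<phi>: "\<And>x. (\<phi> has_real_derivative \<phi>' x) (at x)" and cont': "continuous_on UNIV \<phi>'"
      and supp: "\<And>x. x \<notin> {c..d} \<Longrightarrow> \<phi> x = 0" and supp': "\<And>x. x \<notin> {c..d} \<Longrightarrow> \<phi>' x = 0"
    have cont: "continuous_on UNIV \<phi>"
      using d\<phi> DERIV_isCont by (intro continuous_at_imp_continuous_on) blast
    have 1: "integrable lborel (\<lambda>x. \<phi> x *\<^sub>R w T x)"
      using integrable_correlation[OF w_meas[OF T0(2)] w_L2[OF T0(2)] cont, of c d 0] supp by simp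
    have 2: "integrable lborel (\<lambda>x. \<phi> x * exp (- x))"
      by (rule integrable_compact_support[of _ c d])
         (auto simp: supp intro!: continuous_intros cont)
    have "(LINT x|lborel. \<phi> x *\<^sub>R f x) = (LINT x|lborel. \<phi> x *\<^sub>R w T x - (\<phi> x * exp (- x)) *\<^sub>R uf T)"
      by (simp add: f_def scaleR_diff_right)
    also have "\<dots> = correlation \<phi> (w T) 0 - (LINT x|lborel. \<phi> x * exp (- x)) *\<^sub>R uf T"
      using 1 2 by (simp add: correlation_def)
    finally show "(LINT x|lborel. \<phi> x *\<^sub>R f x) = 0"
      using main[OF cd d\<phi> cont' supp supp'] by simp
  qed
  then show ?thesis
    unfolding lp_def lm_def
  proof eventually_elim
    case (elim p)
    then show ?case by (auto simp: f_def of_real_smult_eq_scaleR exp_minus)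
  qed
qed

end
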